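(* Let $R\ge 1$, $\rho=R-1$, and let $\widehat V_\rho$ be the $q$-ary linear code whose parity check matrix has as columns the homogeneous coordinate vectors (leftmost nonzero coordinate equal to $1$) of the points of the set $S_\rho\subset\mathrm{PG}(2\rho+1,q)$ defined below. (i) If $q=4$ or $q\ge 7$, then for all $R\ge 1$, $\widehat V_\rho$ is an $[Rq+1,Rq+1-2R,3]_qR$ locally optimal code of covering radius $R$. (ii) If $q=5$, then for $1\le R\le 5$, $\widehat V_\rho$ is a $[5R+1,5R+1-2R,3]_5R$ locally optimal code of covering radius $R$.
   Context: With $e_0,\dots,e_{2\rho+1}$ the standard unit vectors of $\mathbb{F}_q^{2\rho+2}$ (viewed as points of $\mathrm{PG}(2\rho+1,q)$), \[ S_\rho=\{e_0\}\cup\{e_0+ae_1: a\in\mathbb{F}_q^*\}\cup\bigcup_{u=1}^{\rho}\Big(\{e_{2u-1}+ae_{2u}+a^2e_{2u+1}: a\in\mathbb{F}_q^*\}\cup\{e_{2u}\}\Big)\cup\{e_{2\rho+1}\}. \] An $[n,n-r,d]_qR$ code is a $q$-ary linear code of length $n$, codimension $r$, minimum distance $d$ and covering radius $R$, where the covering radius is the least $R$ such that every column of $\mathbb{F}_q^r$ is a linear combination of at most $R$ columns of a parity check matrix. A code is locally optimal if one cannot remove any column from its parity check matrix without an increase in covering radius. *)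

theory Defs
  imports
    "Jordan_Normal_Form.Matrix_Kernel"
    "HOL-Library.Extended_Nat"
    "HOL-Library.Cardinality"
begin

section \<open>Linear codes given by a parity check matrix\<close>

definition hamming_dist :: "'a vec \<Rightarrow> 'a vec \<Rightarrow> nat" where
  "hamming_dist u v = card {i. i < dim_vec u \<and> u $ i \<noteq> v $ i}"

text \<open>A code with fewer than two words gets minimum distance \<open>Inf {} = 0\<close>.\<close>

definition min_distance :: "'a vec set \<Rightarrow> nat" where
  "min_distance C = Inf {hamming_dist u v | u v. u \<in> C \<and> v \<in> C \<and> u \<noteq> v}"

abbreviation vec_span :: "nat \<Rightarrow> 'a :: field vec set \<Rightarrow> 'a vec set" where
  "vec_span n \<equiv> LinearCombinations.module.span class_ring (module_vec TYPE('a) n)"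

definition covered_by :: "'a :: field mat \<Rightarrow> nat \<Rightarrow> bool" where
  "covered_by H R \<longleftrightarrow>
     (\<forall>s \<in> carrier_vec (dim_row H).
        \<exists>T \<subseteq> set (cols H). card T \<le> R \<and> s \<in> vec_span (dim_row H) T)"

text \<open>The value is \<open>\<infinity>\<close> exactly when the columns do not span the whole space, so that losing
  the spanning property by deleting a column counts as an increase of the covering radius.\<close>

definition covering_radius :: "'a :: field mat \<Rightarrow> enat" where
  "covering_radius H = Inf {enat R | R. covered_by H R}"

text \<open>\<open>H\<close> is a parity check matrix of an \<open>[n,k,d]\<^sub>qR\<close> code, the code being the kernel of \<open>H\<close>.
  Requiring \<open>n - k\<close> rows together with a kernel of dimension \<open>k\<close> makes the rows of \<open>H\<close> linearly
  independent, so the covering radius refers to the space of dimension equal to the codimension.\<close>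

definition parity_check_of_code ::
    "'a :: field mat \<Rightarrow> nat \<Rightarrow> nat \<Rightarrow> nat \<Rightarrow> nat \<Rightarrow> nat \<Rightarrow> bool" where
  "parity_check_of_code H q n k d R \<longleftrightarrow>
     CARD('a) = q \<and> k \<le> n \<and> H \<in> carrier_mat (n - k) n \<and>
     kernel_dim H = k \<and> min_distance (mat_kernel H) = d \<and> covering_radius H = enat R"

definition delete_col :: "'a mat \<Rightarrow> nat \<Rightarrow> 'a mat" where
  "delete_col H j = mat_of_cols (dim_row H) (take j (cols H) @ drop (Suc j) (cols H))"

definition locally_optimal :: "'a :: field mat \<Rightarrow> bool" where
  "locally_optimal H \<longleftrightarrow> (\<forall>j < dim_col H. covering_radius H < covering_radius (delete_col H j))"

section \<open>Points of projective space\<close>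

text \<open>A point of the projective space is a one-dimensional subspace; \<open>pg_point v\<close> is one whenever
  \<open>v\<close> is nonzero.\<close>

definition pg_point :: "'a :: field vec \<Rightarrow> 'a vec set" where
  "pg_point v = {c \<cdot>\<^sub>v v | c. True}"

definition normalized :: "'a :: field vec \<Rightarrow> bool" where
  "normalized v \<longleftrightarrow> (\<exists>i < dim_vec v. v $ i = 1 \<and> (\<forall>j < i. v $ j = 0))"

text \<open>The order of the columns is left open.\<close>

definition has_point_columns :: "'a :: field mat \<Rightarrow> nat \<Rightarrow> 'a vec set set \<Rightarrow> bool" where
  "has_point_columns H m P \<longleftrightarrow>
     dim_row H = m \<and> distinct (cols H) \<and>
     set (cols H) = {v \<in> carrier_vec m. normalized v \<and> pg_point v \<in> P}"

definition S_set :: "nat \<Rightarrow> 'a :: field vec set set" where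
  "S_set \<rho> = (let e = unit_vec (2 * \<rho> + 2) in
     pg_point ` (
       {e 0} \<union> {e 0 + a \<cdot>\<^sub>v e 1 | a. a \<noteq> 0}
       \<union> (\<Union>u \<in> {1..\<rho>}.
            {e (2 * u - 1) + a \<cdot>\<^sub>v e (2 * u) + a\<^sup>2 \<cdot>\<^sub>v e (2 * u + 1) | a. a \<noteq> 0} \<union> {e (2 * u)})
       \<union> {e (2 * \<rho> + 1)}))"

end

theory Submission
  imports Defs "Jordan_Normal_Form.DL_Rank"
begin

text \<open>Covering: build a vector coordinate by coordinate, block by block. After block \<open>u\<close> either every
  value at the coordinate shared with block \<open>u + 1\<close> costs at most \<open>u + 1\<close> columns, or one value costs
  at most \<open>u\<close> and all others at most \<open>u + 2\<close>; this alternative survives each block, and the final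
  unit vector settles the second case.

  Local optimality: a sum of one column from each of the \<open>\<rho> + 1\<close> blocks is a combination of at most
  \<open>\<rho> + 1\<close> columns in no other way, and without \<open>e (2\<rho> + 1)\<close> some vector costs \<open>\<rho> + 2\<close>.\<close>

section \<open>Spans and kernels\<close>

text \<open>Membership in a span becomes a system of coordinate equations, the form in which every
  later lower bound and every construction is carried out.\<close>

lemma vec_span_iff:
  fixes T :: "'a :: field vec set"
  assumes "finite T" "T \<subseteq> carrier_vec m"
  shows "v \<in> vec_span m T \<longleftrightarrow>
    v \<in> carrier_vec m \<and> (\<exists>c. \<forall>i<m. v $ i = (\<Sum>x\<in>T. c x * x $ i))"
proof -
  interpret vec_space "TYPE('a)" m .
  have "v \<in> span T \<longleftrightarrow> (\<exists>c. v = lincomb c T)"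
    using finite_span[OF assms] by auto
  also have "\<dots> \<longleftrightarrow> v \<in> carrier_vec m \<and> (\<exists>c. \<forall>i<m. v $ i = lincomb c T $ i)"
    using lincomb_dim[OF assms] lincomb_closed[OF assms(2)]
    by (metis carrier_vecD eq_vecI)
  finally show ?thesis
    using lincomb_index[OF _ assms(2)] by simp
qed

text \<open>Rank-nullity for \<open>v \<mapsto> H v\<close>, which is onto because the columns span.
  Distinctness lets a combination of the set of columns be read as a matrix-vector product.\<close>

lemma kernel_dim_of_spanning_cols:
  fixes H :: "'a :: field mat"
  assumes H: "H \<in> carrier_mat m n" and dist: "distinct (cols H)"
    and sp: "carrier_vec m \<subseteq> vec_span m (set (cols H))"
  shows "kernel_dim H + m = n"
proof -
  interpret V: vec_space "TYPE('a)" n .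
  interpret W: vec_space "TYPE('a)" m .
  interpret linear_map class_ring V.V W.V "\<lambda>v. H *\<^sub>v v"
  proof -
    have "mod_hom class_ring V.V W.V (\<lambda>v. H *\<^sub>v v)"
    proof (rule mod_hom.intro)
      show "Module.module class_ring V.V" "Module.module class_ring W.V" by (rule vec_module)+
      show "mod_hom_axioms class_ring V.V W.V (\<lambda>v. H *\<^sub>v v)"
        unfolding mod_hom_axioms_def LinearCombinations.module_hom_def using H
        by (auto simp: module_vec_simps class_ring_simps
            mult_add_distrib_mat_vec[OF H] mult_mat_vec[OF H])
    qed
    then show "linear_map class_ring V.V W.V (\<lambda>v. H *\<^sub>v v)"
      unfolding linear_map_def using vec_vs by auto
  qed
  have surj: "(\<lambda>v. H *\<^sub>v v) ` carrier_vec n = carrier_vec m"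
  proof
    show "(\<lambda>v. H *\<^sub>v v) ` carrier_vec n \<subseteq> carrier_vec m" using H by auto
    show "carrier_vec m \<subseteq> (\<lambda>v. H *\<^sub>v v) ` carrier_vec n"
    proof
      fix v :: "'a vec" assume "v \<in> carrier_vec m"
      then have "v \<in> W.span (set (cols H))" using sp by auto
      moreover have "set (cols H) \<subseteq> carrier_vec m" using H cols_dim by blast
      ultimately obtain c where "v = W.lincomb c (set (cols H))"
        using W.finite_span[of "set (cols H)"] by auto
      then have "v = H *\<^sub>v vec n (\<lambda>i. c (col H i))"
        using W.mat_mult_eq_lincomb[OF H dist] by simp
      then show "v \<in> (\<lambda>v. H *\<^sub>v v) ` carrier_vec n" by auto
    qed
  qed
  have im: "imT = carrier_vec m" using surj by (simp add: im_def)
  have ker: "kerT = mat_kernel H"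
    using H by (auto simp: ker_def mat_kernel_def module_vec_simps)
  interpret K: kernel m n H by (unfold_locales, fact H)
  have "vectorspace.dim class_ring (W.vs imT) + vectorspace.dim class_ring (V.vs kerT) = V.dim"
    by (rule rank_nullity) simp
  moreover have "W.vs imT = W.V" unfolding im by (simp add: module_vec_def)
  ultimately show ?thesis unfolding ker using V.dim_is_n W.dim_is_n K.kernel_dim by simp
qed

section \<open>The columns of the parity check matrix\<close>

text \<open>Proportional vectors have their leading entry at the same position, and there both
  entries are 1, so the factor is 1.\<close>

lemma normalized_unique:
  fixes v w :: "'a :: field vec"
  assumes "normalized v" "normalized w" "dim_vec v = dim_vec w"
    and eq: "\<And>r. r < dim_vec v \<Longrightarrow> v $ r = c * w $ r"
  shows "v = w"
proof -
  obtain i where i: "i < dim_vec v" "v $ i = 1" "\<And>j. j < i \<Longrightarrow> v $ j = 0"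
    using assms(1) unfolding normalized_def by blast
  obtain k where k: "k < dim_vec w" "w $ k = 1" "\<And>j. j < k \<Longrightarrow> w $ j = 0"
    using assms(2) unfolding normalized_def by blast
  have "c \<noteq> 0" using eq[OF i(1)] i(2) by auto
  then have "v $ k \<noteq> 0" using eq[of k] k assms(3) by auto
  then have "\<not> k < i" using i(3) by blast
  moreover have "w $ i \<noteq> 0" using eq[OF i(1)] i(2) by auto
  then have "\<not> i < k" using k(3) by blast
  ultimately have "i = k" by simp
  then have "c = 1" using eq[OF i(1)] i k by simp
  then show ?thesis using eq assms(3) by (intro eq_vecI) auto
qed

lemma pg_point_normalized_inj:
  fixes v w :: "'a :: field vec"
  assumes "normalized v" "normalized w" "pg_point v = pg_point w"
  shows "v = w"
proof -
  have "1 \<cdot>\<^sub>v v \<in> pg_point v" unfolding pg_point_def by blast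
  then obtain c where c: "v = c \<cdot>\<^sub>v w"
    using assms(3) unfolding pg_point_def by auto
  show ?thesis
    by (rule normalized_unique[OF assms(1,2), where c = c]) (auto simp: c)
qed

text \<open>A point has only one normalized representative, so normalized generators are recovered
  from their points.\<close>

lemma normalized_points_eq:
  assumes "G \<subseteq> carrier_vec m" "\<And>g. g \<in> G \<Longrightarrow> normalized g"
  shows "{v \<in> carrier_vec m. normalized v \<and> pg_point v \<in> pg_point ` G} = G"
proof
  show "{v \<in> carrier_vec m. normalized v \<and> pg_point v \<in> pg_point ` G} \<subseteq> G"
    using assms(2) pg_point_normalized_inj by blast
  show "G \<subseteq> {v \<in> carrier_vec m. normalized v \<and> pg_point v \<in> pg_point ` G}"
    using assms by blast
qed

text \<open>The columns are grouped into blocks \<open>u = 0, \<dots>, \<rho>\<close> of \<open>q\<close> vectors each, so that in every block the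
  vector with parameter \<open>a\<close> has, up to a factor, the coordinates \<open>(1, a)\<close> at \<open>(2u, 2u + 1)\<close> and
  only zeros behind. In the conic blocks the nucleus \<open>e (2u)\<close> takes the parameter \<open>0\<close>.\<close>

definition block_col :: "nat \<Rightarrow> nat \<Rightarrow> 'a :: field \<Rightarrow> 'a vec" where
  "block_col m u a = vec m (\<lambda>i.
     if u = 0 then (if i = 0 then 1 else if i = 1 then a else 0)
     else if a = 0 then (if i = 2 * u then 1 else 0)
     else if i = 2 * u - 1 then 1 else if i = 2 * u then a
     else if i = 2 * u + 1 then a\<^sup>2 else 0)"

text \<open>The last unit vector stands outside the blocks: at the two final coordinates it gives
  the direction \<open>(0, 1)\<close>, which no parameter of the last block yields.\<close>

definition all_cols :: "nat \<Rightarrow> 'a :: field vec set" where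
  "all_cols \<rho> = {block_col (2 * \<rho> + 2) u a | u a. u \<le> \<rho>} \<union> {unit_vec (2 * \<rho> + 2) (2 * \<rho> + 1)}"

lemma block_col_carrier [simp]: "block_col m u a \<in> carrier_vec m"
  by (simp add: block_col_def)

lemma dim_block_col [simp]: "dim_vec (block_col m u a) = m"
  by (simp add: block_col_def)

lemma block_col_beyond: "2 * u + 1 < i \<Longrightarrow> i < m \<Longrightarrow> block_col m u a $ i = 0"
  by (simp add: block_col_def)

text \<open>Even coordinates are private to one block; neighbouring blocks overlap only in odd ones.
  All lower bounds rest on this.\<close>

lemma block_col_even:
  "2 * w < m \<Longrightarrow> block_col m u a $ (2 * w) = 0 \<longleftrightarrow> u \<noteq> w"
  by (auto simp: block_col_def)

text \<open>In each case the quotient of the second entry by the first is the parameter itself, so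
  \<open>a = b\<close>; the first entry is nonzero, so \<open>c = 1\<close>.\<close>

lemma block_col_determined:
  assumes "2 * u + 1 < m"
    and "c * block_col m u a $ (2 * u) = block_col m u b $ (2 * u)"
    and "c * block_col m u a $ (2 * u + 1) = block_col m u b $ (2 * u + 1)"
  shows "c = 1 \<and> a = b"
  using assms by (auto simp: block_col_def power2_eq_square split: if_splits)

lemma block_col_inj:
  assumes "block_col m u a = block_col m u' a'" "2 * u + 1 < m"
  shows "u = u' \<and> a = a'"
proof -
  have "u = u'"
    using block_col_even[of u m u a] block_col_even[of u m u' a'] assms by auto
  then show ?thesis
    using block_col_determined[of u m 1 a a'] assms by auto
qed

lemma block_col_neq_last:
  assumes "u \<le> \<rho>"
  shows "block_col (2 * \<rho> + 2) u a \<noteq> unit_vec (2 * \<rho> + 2) (2 * \<rho> + 1)"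
proof
  assume eq: "block_col (2 * \<rho> + 2) u a = unit_vec (2 * \<rho> + 2) (2 * \<rho> + 1)"
  have "block_col (2 * \<rho> + 2) u a $ (2 * u) \<noteq> 0" using assms by (simp add: block_col_even)
  then show False unfolding eq using assms by auto
qed

lemma all_cols_carrier: "all_cols \<rho> \<subseteq> carrier_vec (2 * \<rho> + 2)"
  by (auto simp: all_cols_def)

lemma normalized_all_cols:
  assumes "g \<in> all_cols \<rho>" shows "normalized g"
proof -
  consider u a where "g = block_col (2 * \<rho> + 2) u a" "u \<le> \<rho>"
    | "g = unit_vec (2 * \<rho> + 2) (2 * \<rho> + 1)"
    using assms by (auto simp: all_cols_def)
  then show ?thesis
  proof cases
    case 1
    have "\<exists>i < 2 * \<rho> + 2. g $ i = 1 \<and> (\<forall>j < i. g $ j = 0)"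
      by (rule exI[of _ "if u = 0 then 0 else if a = 0 then 2 * u else 2 * u - 1"])
        (use 1 in \<open>auto simp: block_col_def\<close>)
    then show ?thesis using 1 by (simp add: normalized_def)
  next
    case 2
    then show ?thesis unfolding normalized_def
      by (intro exI[of _ "2 * \<rho> + 1"]) auto
  qed
qed

lemma card_all_cols: "card (all_cols \<rho> :: 'a :: {field, finite} vec set) = (\<rho> + 1) * CARD('a) + 1"
proof -
  let ?f = "\<lambda>(u, a :: 'a). block_col (2 * \<rho> + 2) u a"
  have eq: "{block_col (2 * \<rho> + 2) u a | u (a :: 'a). u \<le> \<rho>} = ?f ` ({..\<rho>} \<times> UNIV)"
    by auto
  have "inj_on ?f ({..\<rho>} \<times> UNIV)"
    by (auto simp: inj_on_def dest!: block_col_inj)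
  then have "card (?f ` ({..\<rho>} \<times> UNIV)) = (\<rho> + 1) * CARD('a)"
    by (simp add: card_image)
  moreover have "unit_vec (2 * \<rho> + 2) (2 * \<rho> + 1) \<notin> ?f ` ({..\<rho>} \<times> UNIV)"
    unfolding eq[symmetric] mem_Collect_eq
  proof
    assume "\<exists>u (a :: 'a). unit_vec (2 * \<rho> + 2) (2 * \<rho> + 1) = block_col (2 * \<rho> + 2) u a \<and> u \<le> \<rho>"
    then show False using block_col_neq_last[symmetric] by blast
  qed
  ultimately show ?thesis unfolding all_cols_def eq by simp
qed

lemma S_set_eq: "S_set \<rho> = pg_point ` all_cols \<rho>"
proof -
  let ?e = "unit_vec (2 * \<rho> + 2) :: nat \<Rightarrow> 'a vec"
  have line: "block_col (2 * \<rho> + 2) 0 a = ?e 0 + a \<cdot>\<^sub>v ?e 1" for a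
    by (intro eq_vecI) (auto simp: block_col_def)
  have line0: "block_col (2 * \<rho> + 2) 0 0 = ?e 0"
    by (intro eq_vecI) (auto simp: block_col_def)
  have nucleus: "block_col (2 * \<rho> + 2) u 0 = ?e (2 * u)" if "u \<in> {1..\<rho>}" for u
    using that by (intro eq_vecI) (auto simp: block_col_def)
  have conic: "block_col (2 * \<rho> + 2) u a
      = ?e (2 * u - 1) + a \<cdot>\<^sub>v ?e (2 * u) + a\<^sup>2 \<cdot>\<^sub>v ?e (2 * u + 1)"
    if "u \<in> {1..\<rho>}" "a \<noteq> 0" for u a
    using that by (intro eq_vecI) (auto simp: block_col_def)
  have "{block_col (2 * \<rho> + 2) u a | u a. u \<le> \<rho>} =
      {block_col (2 * \<rho> + 2) 0 0} \<union> {block_col (2 * \<rho> + 2) 0 a | a. a \<noteq> 0} \<union>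
      (\<Union>u \<in> {1..\<rho>}. {block_col (2 * \<rho> + 2) u a | a. a \<noteq> 0} \<union> {block_col (2 * \<rho> + 2) u (0 :: 'a)})"
    (is "?L = ?A \<union> ?B \<union> ?C")
  proof
    show "?L \<subseteq> ?A \<union> ?B \<union> ?C"
    proof
      fix x assume "x \<in> ?L"
      then obtain u a where x: "x = block_col (2 * \<rho> + 2) u a" "u \<le> \<rho>" by blast
      show "x \<in> ?A \<union> ?B \<union> ?C"
      proof (cases "u = 0")
        case True
        then show ?thesis using x by blast
      next
        case False
        then have "u \<in> {1..\<rho>}" using x by simp
        then show ?thesis using x by blast
      qed
    qed
    show "?A \<union> ?B \<union> ?C \<subseteq> ?L" by force
  qed
  also have "?B = {?e 0 + a \<cdot>\<^sub>v ?e 1 | a. a \<noteq> 0}" by (simp only: line)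
  also have "?C = (\<Union>u \<in> {1..\<rho>}. {?e (2 * u - 1) + a \<cdot>\<^sub>v ?e (2 * u) + a\<^sup>2 \<cdot>\<^sub>v ?e (2 * u + 1) | a. a \<noteq> 0}
      \<union> {?e (2 * u)})"
  proof (rule SUP_cong[OF refl], rule arg_cong2[of _ _ _ _ "(\<union>)"])
    fix u assume u: "u \<in> {1..\<rho>}"
    show "{block_col (2 * \<rho> + 2) u a | a. a \<noteq> 0} =
        {?e (2 * u - 1) + a \<cdot>\<^sub>v ?e (2 * u) + a\<^sup>2 \<cdot>\<^sub>v ?e (2 * u + 1) | a. a \<noteq> 0}"
      by (intro Collect_cong iff_exI) (metis conic[OF u])
    show "{block_col (2 * \<rho> + 2) u 0} = {?e (2 * u)}" by (simp only: nucleus[OF u])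
  qed
  finally show ?thesis unfolding S_set_def all_cols_def Let_def line0 by (simp only:)
qed

lemma normalized_points_S_set:
  "{v \<in> carrier_vec (2 * \<rho> + 2). normalized v \<and> pg_point v \<in> S_set \<rho>} = all_cols \<rho>"
  unfolding S_set_eq using all_cols_carrier normalized_all_cols by (rule normalized_points_eq)

section \<open>Vectors that are expensive to cover\<close>

lemma inj_on_block_choice: "inj_on (\<lambda>u. block_col (2 * \<rho> + 2) u (b u)) {..\<rho>}"
  by (auto simp: inj_on_def dest!: block_col_inj)

text \<open>Only columns of block \<open>w\<close> are nonzero at coordinate \<open>2w\<close>, so a
  nonzero entry there forces one of them into \<open>T\<close>.\<close>

lemma block_hit:
  assumes T: "T \<subseteq> all_cols \<rho>" and w: "w \<le> \<rho>"
    and v: "v $ (2 * w) = (\<Sum>x\<in>T. c x * x $ (2 * w))" "v $ (2 * w) \<noteq> 0"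
  shows "\<exists>a. block_col (2 * \<rho> + 2) w a \<in> T"
proof -
  from v obtain x where x: "x \<in> T" "x $ (2 * w) \<noteq> 0"
    by (metis (no_types, lifting) sum.neutral mult_zero_right)
  have "x \<noteq> unit_vec (2 * \<rho> + 2) (2 * \<rho> + 1)" using x(2) w by auto
  then obtain u a where ua: "x = block_col (2 * \<rho> + 2) u a" "u \<le> \<rho>"
    using x(1) T by (auto simp: all_cols_def)
  then have "u = w" using x(2) w by (simp add: block_col_even)
  then show ?thesis using ua x by blast
qed

text \<open>From the last block downwards, the coordinates \<open>2w\<close> and \<open>2w + 1\<close> involve no block before \<open>w\<close>,
  hence determine the column taken from block \<open>w\<close>.\<close>

lemma block_sum_unique:
  assumes eq: "\<And>i. i < 2 * \<rho> + 2 \<Longrightarrow> (\<Sum>u\<le>\<rho>. l u * block_col (2 * \<rho> + 2) u (a u) $ i)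
      = (\<Sum>u\<le>\<rho>. block_col (2 * \<rho> + 2) u (b u) $ i)"
    and "w \<le> \<rho>"
  shows "l w = 1 \<and> a w = b w"
  using \<open>w \<le> \<rho>\<close>
proof (induction "\<rho> - w" arbitrary: w rule: less_induct)
  case less
  let ?d = "\<lambda>u i. l u * block_col (2 * \<rho> + 2) u (a u) $ i - block_col (2 * \<rho> + 2) u (b u) $ i"
  have "?d w i = 0" if i: "i \<in> {2 * w, 2 * w + 1}" for i
  proof -
    have i': "i < 2 * \<rho> + 2" using i less.prems by auto
    have "(\<Sum>u\<le>\<rho>. ?d u i) = 0" using eq[OF i'] by (simp add: sum_subtractf)
    \<comment> \<open>Blocks before \<open>w\<close> vanish at \<open>i\<close>; those behind
      \<open>w\<close> cancel by the induction hypothesis.\<close>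
    moreover have "(\<Sum>u\<le>\<rho>. ?d u i) = (\<Sum>u\<in>{w}. ?d u i)"
    proof (rule sum.mono_neutral_right)
      show "\<forall>u \<in> {..\<rho>} - {w}. ?d u i = 0"
      proof
        fix u assume u: "u \<in> {..\<rho>} - {w}"
        show "?d u i = 0"
        proof (cases "u < w")
          case True
          then have "2 * u + 1 < i" using i by auto
          then show ?thesis using i' by (simp add: block_col_beyond)
        next
          case False
          then have "w < u" "u \<le> \<rho>" using u by auto
          then show ?thesis using less.hyps[of u] by simp
        qed
      qed
    qed (use less.prems in auto)
    ultimately show ?thesis by simp
  qed
  then show ?case
    using block_col_determined[of w "2 * \<rho> + 2" "l w" "a w" "b w"] less.prems by simp
qed

lemma block_sum_even_nonzero:
  assumes "w \<le> \<rho>"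
  shows "(\<Sum>u\<le>\<rho>. block_col (2 * \<rho> + 2) u (b u) $ (2 * w)) \<noteq> 0"
proof -
  have "(\<Sum>u\<le>\<rho>. block_col (2 * \<rho> + 2) u (b u) $ (2 * w))
      = (\<Sum>u\<in>{w}. block_col (2 * \<rho> + 2) u (b u) $ (2 * w))"
    by (rule sum.mono_neutral_right) (use assms in \<open>auto simp: block_col_even\<close>)
  then show ?thesis using assms by (simp add: block_col_even)
qed

text \<open>The nonzero even coordinates force a column from each of the \<open>\<rho> + 1\<close>
  blocks. This exhausts the allowed cardinality, so \<open>T\<close> has exactly one column per
  block, and \<open>block_sum_unique\<close> identifies their parameters.\<close>

lemma unique_representation:
  assumes T: "finite T" "T \<subseteq> all_cols \<rho>" "card T \<le> \<rho> + 1"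
    and v: "v \<in> vec_span (2 * \<rho> + 2) T"
      "\<And>i. i < 2 * \<rho> + 2 \<Longrightarrow> v $ i = (\<Sum>u\<le>\<rho>. block_col (2 * \<rho> + 2) u (b u) $ i)"
  shows "T = (\<lambda>u. block_col (2 * \<rho> + 2) u (b u)) ` {..\<rho>}"
proof -
  let ?D = "block_col (2 * \<rho> + 2)"
  obtain c where c: "\<And>i. i < 2 * \<rho> + 2 \<Longrightarrow> v $ i = (\<Sum>x\<in>T. c x * x $ i)"
    using v(1) vec_span_iff[OF T(1) subset_trans[OF T(2) all_cols_carrier]] by blast
  have "\<forall>w. \<exists>a. w \<le> \<rho> \<longrightarrow> ?D w a \<in> T"
  proof
    fix w
    show "\<exists>a. w \<le> \<rho> \<longrightarrow> ?D w a \<in> T"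
      using block_hit[OF T(2), of w v c] c[of "2 * w"] v(2)[of "2 * w"]
        block_sum_even_nonzero[of w \<rho> b] by (cases "w \<le> \<rho>") auto
  qed
  then obtain a where a: "\<And>w. w \<le> \<rho> \<Longrightarrow> ?D w (a w) \<in> T" by metis
  have "(\<lambda>u. ?D u (a u)) ` {..\<rho>} \<subseteq> T" using a by auto
  moreover have "card ((\<lambda>u. ?D u (a u)) ` {..\<rho>}) = \<rho> + 1"
    by (subst card_image[OF inj_on_block_choice]) simp
  ultimately have TA: "T = (\<lambda>u. ?D u (a u)) ` {..\<rho>}"
    using T by (metis card_seteq)
  have "a w = b w" if "w \<le> \<rho>" for w
  proof -
    have "(\<Sum>u\<le>\<rho>. c (?D u (a u)) * ?D u (a u) $ i) = (\<Sum>u\<le>\<rho>. ?D u (b u) $ i)"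
      if "i < 2 * \<rho> + 2" for i
      using c[OF that] v(2)[OF that] unfolding TA sum.reindex[OF inj_on_block_choice] comp_def
      by simp
    then show ?thesis using block_sum_unique[where l = "\<lambda>u. c (?D u (a u))"] that by blast
  qed
  then show ?thesis unfolding TA by auto
qed

text \<open>The first disjunct serves the lower bound on the covering radius, the second the
  deletion of a block column. The parameter \<open>0\<close> in the blocks other than
  \<open>u\<close> is an arbitrary choice.\<close>

lemma not_covered_without_block_col:
  assumes T: "finite T" "T \<subseteq> all_cols \<rho>" "card T \<le> \<rho> + 1"
    and no: "card T < \<rho> + 1 \<or> (u \<le> \<rho> \<and> block_col (2 * \<rho> + 2) u a \<notin> T)"
  shows "vec (2 * \<rho> + 2) (\<lambda>i. \<Sum>w\<le>\<rho>. block_col (2 * \<rho> + 2) w (if w = u then a else 0) $ i)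
    \<notin> vec_span (2 * \<rho> + 2) T" (is "?v \<notin> _")
proof
  assume "?v \<in> vec_span (2 * \<rho> + 2) T"
  then have T': "T = (\<lambda>w. block_col (2 * \<rho> + 2) w (if w = u then a else 0)) ` {..\<rho>}"
    by (intro unique_representation[OF T]) auto
  have "card T = \<rho> + 1"
    unfolding T' by (subst card_image[OF inj_on_block_choice]) simp
  moreover have "u \<le> \<rho> \<Longrightarrow> block_col (2 * \<rho> + 2) u a \<in> T"
    unfolding T' by (rule image_eqI[of _ _ u]) auto
  ultimately show False using no by simp
qed

text \<open>Without the last column the last block must produce \<open>(0, 1)\<close> in its two final coordinates,
  which takes two of its columns.\<close>

lemma not_covered_without_last:
  assumes T: "finite T" "T \<subseteq> all_cols \<rho> - {unit_vec (2 * \<rho> + 2) (2 * \<rho> + 1)}" "card T \<le> \<rho> + 1"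
  shows "vec (2 * \<rho> + 2) (\<lambda>i. if i = 2 * \<rho> \<or> odd i \<and> i < 2 * \<rho> then 0 else 1)
    \<notin> vec_span (2 * \<rho> + 2) T" (is "?v \<notin> _")
proof
  let ?D = "block_col (2 * \<rho> + 2)"
  assume "?v \<in> vec_span (2 * \<rho> + 2) T"
  moreover have sub: "T \<subseteq> all_cols \<rho>" using T by blast
  ultimately obtain c where c: "\<And>i. i < 2 * \<rho> + 2 \<Longrightarrow> ?v $ i = (\<Sum>x\<in>T. c x * x $ i)"
    using vec_span_iff[OF T(1) subset_trans[OF sub all_cols_carrier]] by blast
  \<comment> \<open>The entries 1 at even positions below \<open>2\<rho>\<close> force one column
    from each of the \<open>\<rho>\<close> earlier blocks. With two from the last block,
    \<open>T\<close> would have \<open>\<rho> + 2\<close> elements.\<close>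
  have "\<forall>w. \<exists>a. w < \<rho> \<longrightarrow> ?D w a \<in> T"
  proof
    fix w
    show "\<exists>a. w < \<rho> \<longrightarrow> ?D w a \<in> T"
      using block_hit[OF sub, of w ?v c] c[of "2 * w"] by (cases "w < \<rho>") auto
  qed
  then obtain a where a: "\<And>w. w < \<rho> \<Longrightarrow> ?D w (a w) \<in> T" by metis
  let ?B = "T \<inter> range (?D \<rho>)"
  have last: "?v $ i = (\<Sum>x\<in>?B. c x * x $ i)" if "i = 2 * \<rho> \<or> i = 2 * \<rho> + 1" for i
  proof -
    have i: "i < 2 * \<rho> + 2" using that by auto
    have "(\<Sum>x\<in>T. c x * x $ i) = (\<Sum>x\<in>?B. c x * x $ i)"
    proof (rule sum.mono_neutral_right)
      show "\<forall>x \<in> T - ?B. c x * x $ i = 0"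
      proof
        fix x assume x: "x \<in> T - ?B"
        then have "x \<in> all_cols \<rho>" "x \<noteq> unit_vec (2 * \<rho> + 2) (2 * \<rho> + 1)" using T(2) by blast+
        then obtain u b where ub: "x = ?D u b" "u \<le> \<rho>"
          unfolding all_cols_def by blast
        then have "u < \<rho>" using x by (cases "u = \<rho>") auto
        then have "2 * u + 1 < i" using that by auto
        then show "c x * x $ i = 0" using ub i by (simp add: block_col_beyond)
      qed
    qed (use T in auto)
    then show ?thesis using c[OF i] by simp
  qed
  have "finite ?B" using T by simp
  have "card ?B \<ge> 2"
  proof (rule ccontr)
    assume "\<not> card ?B \<ge> 2"
    then have "card ?B = 0 \<or> card ?B = 1" by linarith
    then consider "?B = {}" | x where "?B = {x}"
      using \<open>finite ?B\<close> by (auto simp: card_1_singleton_iff)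
    then show False
    proof cases
      case 1
      then show ?thesis using last[of "2 * \<rho> + 1"] by simp
    next
      case 2
      then obtain b where b: "x = ?D \<rho> b" by blast
      have "c x * x $ (2 * \<rho>) = 0" using last[of "2 * \<rho>"] 2 by simp
      then have "c x = 0" using b by (simp add: block_col_even)
      then show ?thesis using last[of "2 * \<rho> + 1"] 2 by simp
    qed
  qed
  moreover have "inj_on (\<lambda>w. ?D w (a w)) {..<\<rho>}"
    by (rule inj_on_subset[OF inj_on_block_choice]) auto
  then have "card ((\<lambda>w. ?D w (a w)) ` {..<\<rho>}) = \<rho>"
    by (metis card_image card_lessThan)
  moreover have "(\<lambda>w. ?D w (a w)) ` {..<\<rho>} \<inter> ?B = {}"
    by (auto dest: block_col_inj)
  ultimately have "card ((\<lambda>w. ?D w (a w)) ` {..<\<rho>} \<union> ?B) \<ge> \<rho> + 2"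
    using \<open>finite ?B\<close> by (subst card_Un_disjoint) auto
  moreover have "(\<lambda>w. ?D w (a w)) ` {..<\<rho>} \<union> ?B \<subseteq> T" using a by auto
  then have "card ((\<lambda>w. ?D w (a w)) ` {..<\<rho>} \<union> ?B) \<le> card T" by (rule card_mono[OF T(1)])
  ultimately show False using T(3) by linarith
qed

section \<open>Covering every vector\<close>

text \<open>The cost of \<open>v\<close> is at most \<open>k\<close>. Finiteness is demanded because
  \<open>card\<close> of an infinite set is 0.\<close>

definition reach :: "nat \<Rightarrow> nat \<Rightarrow> 'a :: field vec \<Rightarrow> bool" where
  "reach \<rho> k v \<longleftrightarrow>
    (\<exists>T \<subseteq> all_cols \<rho>. finite T \<and> card T \<le> k \<and> v \<in> vec_span (2 * \<rho> + 2) T)"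

lemma reach_mono: "reach \<rho> k v \<Longrightarrow> k \<le> l \<Longrightarrow> reach \<rho> l v"
  unfolding reach_def by (meson order_trans)

lemma reach_zero: "reach \<rho> 0 (0\<^sub>v (2 * \<rho> + 2))"
proof -
  have "0\<^sub>v (2 * \<rho> + 2) \<in> vec_span (2 * \<rho> + 2) {}"
    by (subst vec_span_iff) auto
  then show ?thesis unfolding reach_def by (intro exI[of _ "{}"]) auto
qed

lemma reach_add:
  assumes "reach \<rho> k v" "g \<in> all_cols \<rho>" "w \<in> carrier_vec (2 * \<rho> + 2)"
    and w: "\<And>i. i < 2 * \<rho> + 2 \<Longrightarrow> w $ i = v $ i + l * g $ i"
  shows "reach \<rho> (Suc k) w"
proof -
  obtain T where T: "T \<subseteq> all_cols \<rho>" "finite T" "card T \<le> k" "v \<in> vec_span (2 * \<rho> + 2) T"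
    using assms(1) unfolding reach_def by blast
  obtain c where c: "\<And>i. i < 2 * \<rho> + 2 \<Longrightarrow> v $ i = (\<Sum>x\<in>T. c x * x $ i)"
    using T(4) vec_span_iff[OF T(2) subset_trans[OF T(1) all_cols_carrier]] by blast
  \<comment> \<open>The coefficients are added because \<open>g\<close> may already lie in
    \<open>T\<close>.\<close>
  define d where "d x = (if x \<in> T then c x else 0) + (if x = g then l else 0)" for x
  have sub: "insert g T \<subseteq> all_cols \<rho>" using assms(2) T(1) by blast
  have "w $ i = (\<Sum>x\<in>insert g T. d x * x $ i)" if "i < 2 * \<rho> + 2" for i
  proof -
    have "(\<Sum>x\<in>insert g T. d x * x $ i) = (\<Sum>x\<in>insert g T. (if x \<in> T then c x * x $ i else 0))
        + (\<Sum>x\<in>insert g T. if x = g then l * g $ i else 0)"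
      unfolding sum.distrib[symmetric] d_def by (rule sum.cong) (auto simp: algebra_simps)
    also have "(\<Sum>x\<in>insert g T. (if x \<in> T then c x * x $ i else 0)) = (\<Sum>x\<in>T. c x * x $ i)"
      by (rule sum.mono_neutral_cong_right) (use T(2) in auto)
    also have "(\<Sum>x\<in>insert g T. if x = g then l * g $ i else 0) = l * g $ i"
      using T(2) by (simp add: sum.delta)
    finally show ?thesis using w[OF that] c[OF that] by simp
  qed
  then have "w \<in> vec_span (2 * \<rho> + 2) (insert g T)"
    using vec_span_iff[of "insert g T"] T(2) assms(3) subset_trans[OF sub all_cols_carrier] by blast
  moreover have "card (insert g T) \<le> Suc k" using T(2,3) by (simp add: card_insert_if)
  ultimately show ?thesis unfolding reach_def using sub T(2) by blast
qed

lemma reach_add2: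
  assumes "reach \<rho> k v" "g \<in> all_cols \<rho>" "g' \<in> all_cols \<rho>" "w \<in> carrier_vec (2 * \<rho> + 2)"
    and w: "\<And>i. i < 2 * \<rho> + 2 \<Longrightarrow> w $ i = v $ i + l * g $ i + l' * g' $ i"
  shows "reach \<rho> (Suc (Suc k)) w"
proof -
  have "reach \<rho> (Suc k) (vec (2 * \<rho> + 2) (\<lambda>i. v $ i + l * g $ i))"
    using assms(1,2) by (rule reach_add) auto
  then show ?thesis using assms(3,4) by (rule reach_add) (use w in auto)
qed

lemma reach_add3:
  assumes "reach \<rho> k v" "g \<in> all_cols \<rho>" "g' \<in> all_cols \<rho>" "g'' \<in> all_cols \<rho>"
    and "w \<in> carrier_vec (2 * \<rho> + 2)"
    and w: "\<And>i. i < 2 * \<rho> + 2 \<Longrightarrow> w $ i = v $ i + l * g $ i + l' * g' $ i + l'' * g'' $ i"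
  shows "reach \<rho> (Suc (Suc (Suc k))) w"
proof -
  have "reach \<rho> (Suc (Suc k)) (vec (2 * \<rho> + 2) (\<lambda>i. v $ i + l * g $ i + l' * g' $ i))"
    using assms(1,2,3) by (rule reach_add2) auto
  then show ?thesis using assms(4,5) by (rule reach_add) (use w in auto)
qed

lemma block_col_in: "u \<le> \<rho> \<Longrightarrow> block_col (2 * \<rho> + 2) u a \<in> all_cols \<rho>"
  by (auto simp: all_cols_def)

text \<open>If all nonzero squares equalled \<open>c\<close>, they would equal 1, leaving only
  \<open>0\<close>, \<open>1\<close> and \<open>- 1\<close>. The covering argument uses the field
  size only through this fact.\<close>

lemma ex_nonzero_square_neq:
  assumes "CARD('a :: {field, finite}) \<ge> 4"
  shows "\<exists>r :: 'a. r \<noteq> 0 \<and> r\<^sup>2 \<noteq> c"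
proof (rule ccontr)
  assume *: "\<not> ?thesis"
  have "\<exists>s. (UNIV :: 'a set) \<subseteq> {0, s, - s}"
  proof -
    have "(1 :: 'a)\<^sup>2 = c" using * by (metis one_neq_zero)
    then have "r = 0 \<or> r\<^sup>2 = 1\<^sup>2" for r :: 'a using * by metis
    then have "UNIV \<subseteq> {0, 1, - 1 :: 'a}" using power2_eq_iff by blast
    then show ?thesis by blast
  qed
  then obtain s where "(UNIV :: 'a set) \<subseteq> {0, s, - s}" by blast
  then have "CARD('a) \<le> card {0, s, - s}" by (rule card_mono[rotated]) simp
  also have "\<dots> \<le> 3" by (simp add: card_insert_if)
  finally show False using assms by simp
qed

text \<open>\<open>prefix_vec \<rho> x u s\<close> agrees with \<open>x\<close> on the coordinates that only the blocks \<open>0, \<dots>, u\<close> can reach and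
  has \<open>s\<close> at the coordinate shared with block \<open>u + 1\<close>.\<close>

definition prefix_vec :: "nat \<Rightarrow> 'a :: field vec \<Rightarrow> nat \<Rightarrow> 'a \<Rightarrow> 'a vec" where
  "prefix_vec \<rho> x u s =
     vec (2 * \<rho> + 2) (\<lambda>i. if i \<le> 2 * u then x $ i else if i = 2 * u + 1 then s else 0)"

lemma dim_prefix_vec [simp]: "dim_vec (prefix_vec \<rho> x u s) = 2 * \<rho> + 2"
  by (simp add: prefix_vec_def)

lemma prefix_vec_carrier [simp]: "prefix_vec \<rho> x u s \<in> carrier_vec m \<longleftrightarrow> m = 2 * \<rho> + 2"
  unfolding carrier_vec_def mem_Collect_eq dim_prefix_vec by (rule eq_commute)

section \<open>Extending a prefix by one conic block\<close>

context
  fixes \<rho> u :: nat and x :: "'a :: field vec" and s a b :: 'a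
  assumes u: "u < \<rho>"
  defines "a \<equiv> x $ (2 * u + 1) - s" and "b \<equiv> x $ (2 * u + 2)"
begin

text \<open>Block \<open>u + 1\<close> must contribute the triple \<open>(a, b, t)\<close>: the
  remainder at the coordinate shared with block \<open>u\<close>, the entry at its private
  coordinate, and the value handed to the next block. The step lemmas below realise such
  triples.\<close>

lemma prefix_Suc_index:
  assumes "i < 2 * \<rho> + 2"
  shows "prefix_vec \<rho> x (Suc u) t $ i = prefix_vec \<rho> x u s $ i +
    (if i = 2 * u + 1 then a else if i = 2 * u + 2 then b else if i = 2 * u + 3 then t else 0)"
proof -
  consider "i \<le> 2 * u" | "i = 2 * u + 1" | "i = 2 * u + 2" | "i = 2 * u + 3" | "i > 2 * u + 3"
    by linarith
  then show ?thesis using assms by cases (auto simp: prefix_vec_def a_def b_def)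
qed

lemma prefix_step0:
  assumes "reach \<rho> k (prefix_vec \<rho> x u s)" "a = 0" "b = 0"
  shows "reach \<rho> k (prefix_vec \<rho> x (Suc u) 0)"
proof -
  have "prefix_vec \<rho> x (Suc u) 0 = prefix_vec \<rho> x u s"
    by (rule eq_vecI) (auto simp: prefix_Suc_index assms)
  then show ?thesis using assms by simp
qed

text \<open>The triple \<open>(0, b, 0)\<close> is a multiple of the nucleus.\<close>

lemma prefix_step_nucleus:
  assumes "reach \<rho> k (prefix_vec \<rho> x u s)" "a = 0"
  shows "reach \<rho> (k + 1) (prefix_vec \<rho> x (Suc u) 0)"
proof -
  have "reach \<rho> (Suc k) (prefix_vec \<rho> x (Suc u) 0)"
    by (rule reach_add[OF assms(1) block_col_in[of "Suc u" _ 0], where l = b])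
      (use u assms in \<open>auto simp: prefix_Suc_index block_col_def\<close>)
  then show ?thesis by simp
qed

text \<open>The triple is \<open>a\<close> times the conic point with parameter
  \<open>b / a\<close>.\<close>

lemma prefix_step_conic:
  assumes "reach \<rho> k (prefix_vec \<rho> x u s)" "a \<noteq> 0" "b \<noteq> 0"
  shows "reach \<rho> (k + 1) (prefix_vec \<rho> x (Suc u) (b\<^sup>2 / a))"
proof -
  have "reach \<rho> (Suc k) (prefix_vec \<rho> x (Suc u) (b\<^sup>2 / a))"
    by (rule reach_add[OF assms(1) block_col_in[of "Suc u" _ "b / a"], where l = a])
      (use u assms in \<open>auto simp: prefix_Suc_index block_col_def field_simps power2_eq_square\<close>)
  then show ?thesis by simp
qed

text \<open>The point \<open>(a, 0, t)\<close> lies on the secant through the conic points with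
  parameters \<open>r\<close> and \<open>r'\<close> when \<open>r * r' = - t / a\<close>. The
  condition on \<open>r\<^sup>2\<close> keeps the two parameters distinct.\<close>

lemma prefix_step_secant:
  assumes "reach \<rho> k (prefix_vec \<rho> x u s)" "a \<noteq> 0" "b = 0" "t \<noteq> 0"
    and r: "r \<noteq> 0" "r\<^sup>2 \<noteq> - t / a"
  shows "reach \<rho> (k + 2) (prefix_vec \<rho> x (Suc u) t)"
proof -
  define r' where "r' = - t / (a * r)"
  have r': "r' \<noteq> 0" "r * r' = - t / a" "r' \<noteq> r"
    using assms by (auto simp: r'_def field_simps power2_eq_square)
  define l where "l = a * r' / (r' - r)"
  have l: "l + (a - l) = a" "l * r + (a - l) * r' = 0" "l * r\<^sup>2 + (a - l) * r'\<^sup>2 = t"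
  proof -
    show l2: "l * r + (a - l) * r' = 0" using r' by (simp add: l_def field_simps)
    have "l * r\<^sup>2 + (a - l) * r'\<^sup>2 = (l * r + (a - l) * r') * (r + r') - a * (r * r')"
      by (simp add: algebra_simps power2_eq_square)
    then show "l * r\<^sup>2 + (a - l) * r'\<^sup>2 = t" using l2 r'(2) assms(2) by simp
  qed simp
  have "reach \<rho> (Suc (Suc k)) (prefix_vec \<rho> x (Suc u) t)"
    by (rule reach_add2[OF assms(1) block_col_in[of "Suc u" _ r] block_col_in[of "Suc u" _ r'],
          where l = l and l' = "a - l"])
      (use u assms l r' in \<open>auto simp: prefix_Suc_index block_col_def add.assoc\<close>)
  then show ?thesis by simp
qed

text \<open>The conic points with parameters \<open>1\<close> and \<open>r\<close> settle the outer
  coordinates, as \<open>r\<^sup>2 \<noteq> 1\<close> makes \<open>(1, 1)\<close> and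
  \<open>(1, r\<^sup>2)\<close> independent; the nucleus then corrects the middle one.\<close>

lemma prefix_step_plane:
  assumes "reach \<rho> k (prefix_vec \<rho> x u s)" and r: "(r :: 'a) \<noteq> 0" "r\<^sup>2 \<noteq> 1"
  shows "reach \<rho> (k + 3) (prefix_vec \<rho> x (Suc u) t)"
proof -
  define l where "l = (t - a) / (r\<^sup>2 - 1)"
  have l: "(a - l) + l = a" "(a - l) + l * r\<^sup>2 = t"
  proof -
    have "l * (r\<^sup>2 - 1) = t - a" using r by (simp add: l_def)
    then show "(a - l) + l * r\<^sup>2 = t" by (simp add: algebra_simps)
  qed simp
  have "reach \<rho> (Suc (Suc (Suc k))) (prefix_vec \<rho> x (Suc u) t)"
    by (rule reach_add3[OF assms(1) block_col_in[of "Suc u" _ 1] block_col_in[of "Suc u" _ r]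
          block_col_in[of "Suc u" _ 0], where l = "a - l" and l' = l and l'' = "b - (a - l) - l * r"])
      (use u r l in \<open>auto simp: prefix_Suc_index block_col_def add.assoc\<close>)
  then show ?thesis by (simp add: numeral_3_eq_3)
qed

end

text \<open>Block 0 supplies the vectors \<open>(1, a)\<close>. If \<open>x $ 0 = 0\<close>, the
  value \<open>t\<close> comes from the difference of two of them, scaled by
  \<open>t\<close>.\<close>

lemma prefix_base:
  "x $ 0 \<noteq> 0 \<Longrightarrow> reach \<rho> 1 (prefix_vec \<rho> x 0 t)"
  "x $ 0 = 0 \<Longrightarrow> reach \<rho> 0 (prefix_vec \<rho> x 0 0)"
  "x $ 0 = 0 \<Longrightarrow> reach \<rho> 2 (prefix_vec \<rho> x 0 t)"
proof -
  assume "x $ 0 \<noteq> 0"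
  then have "reach \<rho> (Suc 0) (prefix_vec \<rho> x 0 t)"
    by (intro reach_add[OF reach_zero block_col_in[of 0 _ "t / x $ 0"], where l = "x $ 0"])
      (auto simp: prefix_vec_def block_col_def)
  then show "reach \<rho> 1 (prefix_vec \<rho> x 0 t)" by simp
next
  assume "x $ 0 = 0"
  then have "prefix_vec \<rho> x 0 0 = 0\<^sub>v (2 * \<rho> + 2)"
    by (intro eq_vecI) (auto simp: prefix_vec_def)
  then show "reach \<rho> 0 (prefix_vec \<rho> x 0 0)" using reach_zero by metis
next
  assume "x $ 0 = 0"
  then have "reach \<rho> (Suc (Suc 0)) (prefix_vec \<rho> x 0 t)"
    by (intro reach_add2[OF reach_zero block_col_in[of 0 _ 1] block_col_in[of 0 _ 0],
          where l = t and l' = "- t"])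
      (auto simp: prefix_vec_def block_col_def)
  then show "reach \<rho> 2 (prefix_vec \<rho> x 0 t)" by (simp add: numeral_2_eq_2)
qed

text \<open>When every value is cheap, it can be chosen to suit the block, and \<open>b\<close>
  decides which alternative follows. When only \<open>s\<close> is cheap, three columns reach every
  \<open>t\<close>, and one column reaches a single \<open>t\<close> unless
  \<open>a \<noteq> s\<close> and \<open>b = 0\<close>; in that case each \<open>t\<close> is
  reached within the smaller bound.\<close>

lemma prefix_cover:
  fixes x :: "'a :: {field, finite} vec"
  assumes q: "CARD('a) \<ge> 4" and "u \<le> \<rho>"
  shows "(\<forall>t. reach \<rho> (u + 1) (prefix_vec \<rho> x u t)) \<or>
    (\<exists>s. reach \<rho> u (prefix_vec \<rho> x u s) \<and> (\<forall>t. reach \<rho> (u + 2) (prefix_vec \<rho> x u t)))"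
  using \<open>u \<le> \<rho>\<close>
proof (induction u)
  case 0
  then show ?case using prefix_base[of x \<rho>] by (cases "x $ 0 = 0") (auto simp: numeral_2_eq_2)
next
  case (Suc u)
  then have u: "u < \<rho>" by simp
  let ?y = "prefix_vec \<rho> x u" and ?z = "prefix_vec \<rho> x (Suc u)"
  \<comment> \<open>Here \<open>a\<close> is the full entry, since the incoming value varies; the
    remainder of the step lemmas appears as \<open>a - s\<close>.\<close>
  define a b where "a = x $ (2 * u + 1)" and "b = x $ (2 * u + 2)"
  note step0 = prefix_step0[OF u, of _ x, folded a_def b_def]
    and nucleus = prefix_step_nucleus[OF u, of _ x, folded a_def]
    and conic = prefix_step_conic[OF u, of _ x, folded a_def b_def]
    and plane = prefix_step_plane[OF u, of _ x]
    and secant = prefix_step_secant[OF u, of _ x, folded a_def b_def]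
  obtain r0 :: 'a where r0: "r0 \<noteq> 0" "r0\<^sup>2 \<noteq> 1"
    using ex_nonzero_square_neq[OF q] by blast
  have secant': "reach \<rho> (k + 2) (?z t)"
    if "reach \<rho> k (?y s)" "a - s \<noteq> 0" "b = 0" "t \<noteq> 0" for k s t
  proof -
    obtain r :: 'a where "r \<noteq> 0" "r\<^sup>2 \<noteq> - t / (a - s)"
      using ex_nonzero_square_neq[OF q] by blast
    then show ?thesis using secant that by blast
  qed
  consider (all) "\<forall>t. reach \<rho> (u + 1) (?y t)"
    | (one) s where "reach \<rho> u (?y s)" "\<forall>t. reach \<rho> (u + 2) (?y t)"
    using Suc by auto
  then show ?case
  proof cases
    case all
    show ?thesis
    proof (cases "b = 0")
      case True
      have "reach \<rho> (Suc u) (?z 0)" using step0[of "u + 1" a] all True by simp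
      moreover have "reach \<rho> (Suc u + 2) (?z t)" for t
      proof (cases "t = 0")
        case True
        then show ?thesis using \<open>reach \<rho> (Suc u) (?z 0)\<close> by (auto intro: reach_mono)
      next
        case False
        \<comment> \<open>The incoming value \<open>a - 1\<close> leaves the nonzero remainder
          1.\<close>
        then show ?thesis using secant'[of "u + 1" "a - 1" t] all True by simp
      qed
      ultimately show ?thesis by blast
    next
      case False
      have "reach \<rho> (Suc u + 1) (?z t)" for t
      proof (cases "t = 0")
        case True
        then show ?thesis using nucleus[of "u + 1" a] all by simp
      next
        case t: False
        \<comment> \<open>This incoming value leaves the remainder \<open>b\<^sup>2 / t\<close>,
          from which one conic column hands on exactly \<open>t\<close>.\<close>
        then show ?thesis using conic[of "u + 1" "a - b\<^sup>2 / t"] all False by simp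
      qed
      then show ?thesis by blast
    qed
  next
    case one
    have three: "reach \<rho> (Suc u + 2) (?z t)" for t
      using plane[OF one(1) r0, of t] by (simp add: numeral_3_eq_3)
    consider "a = s" | "a \<noteq> s" "b \<noteq> 0" | "a \<noteq> s" "b = 0" by blast
    then show ?thesis
    proof cases
      case 1
      then have "reach \<rho> (Suc u) (?z 0)" using nucleus[OF one(1)] by simp
      then show ?thesis using three by blast
    next
      case 2
      then have "reach \<rho> (Suc u) (?z (b\<^sup>2 / (a - s)))" using conic[OF one(1)] by simp
      then show ?thesis using three by blast
    next
      case 3
      have "reach \<rho> (Suc u + 1) (?z t)" for t
      proof (cases "t = 0")
        case True
        \<comment> \<open>Entering with \<open>a\<close> itself costs up to \<open>u + 2\<close>,
          but the block then contributes nothing.\<close>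
        then show ?thesis using step0[of "u + 2" a] one(2) 3 by simp
      next
        case False
        then show ?thesis using secant'[OF one(1)] 3 by simp
      qed
      then show ?thesis by blast
    qed
  qed
qed

lemma reach_all:
  fixes x :: "'a :: {field, finite} vec"
  assumes q: "CARD('a) \<ge> 4" and x: "x \<in> carrier_vec (2 * \<rho> + 2)"
  shows "reach \<rho> (\<rho> + 1) x"
proof -
  have full: "prefix_vec \<rho> x \<rho> (x $ (2 * \<rho> + 1)) = x"
    using x by (intro eq_vecI) (auto simp: prefix_vec_def elim!: less_SucE)
  show ?thesis using prefix_cover[OF q order_refl, of \<rho> x]
  proof (elim disjE exE conjE)
    assume "\<forall>t. reach \<rho> (\<rho> + 1) (prefix_vec \<rho> x \<rho> t)"
    then show ?thesis using full by metis
  next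
    fix s assume "reach \<rho> \<rho> (prefix_vec \<rho> x \<rho> s)"
    then have "reach \<rho> (Suc \<rho>) x"
      by (rule reach_add[where g = "unit_vec (2 * \<rho> + 2) (2 * \<rho> + 1)" and l = "x $ (2 * \<rho> + 1) - s"])
        (use x in \<open>auto simp: all_cols_def prefix_vec_def elim!: less_SucE\<close>)
    then show ?thesis by simp
  qed
qed

section \<open>Code parameters\<close>

text \<open>One vector that no \<open>k\<close> columns cover bounds every admissible
  \<open>R\<close> from below. If there is no admissible \<open>R\<close>, the radius is infinite
  and the bound still holds.\<close>

lemma covering_radius_geI:
  assumes "s \<in> carrier_vec (dim_row H)"
    and "\<And>T. T \<subseteq> set (cols H) \<Longrightarrow> card T \<le> k \<Longrightarrow> s \<notin> vec_span (dim_row H) T"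
  shows "enat (Suc k) \<le> covering_radius H"
  unfolding covering_radius_def
proof (rule Inf_greatest)
  fix e assume "e \<in> {enat R |R. covered_by H R}"
  then obtain R where R: "e = enat R" "covered_by H R" by blast
  have "\<not> R \<le> k"
  proof
    assume "R \<le> k"
    obtain T where "T \<subseteq> set (cols H)" "card T \<le> R" "s \<in> vec_span (dim_row H) T"
      using R(2) assms(1) unfolding covered_by_def by blast
    then show False using assms(2) \<open>R \<le> k\<close> by (meson order_trans)
  qed
  then show "enat (Suc k) \<le> e" using R by simp
qed

lemma cols_delete_col: "cols (delete_col H j) = take j (cols H) @ drop (Suc j) (cols H)"
proof -
  have "set (take j (cols H) @ drop (Suc j) (cols H)) \<subseteq> carrier_vec (dim_row H)"
    using cols_dim[of H] set_take_subset set_drop_subset by (metis Un_least order_trans set_append)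
  then show ?thesis unfolding delete_col_def by (rule cols_mat_of_cols)
qed

lemma set_cols_delete_col:
  assumes "distinct (cols H)" "j < dim_col H"
  shows "set (cols (delete_col H j)) = set (cols H) - {col H j}"
proof -
  have *: "cols H = take j (cols H) @ col H j # drop (Suc j) (cols H)"
    using assms(2) id_take_nth_drop[of j "cols H"] by simp
  then have "distinct (take j (cols H) @ col H j # drop (Suc j) (cols H))"
    using assms(1) by simp
  moreover have "set (cols H) = set (take j (cols H) @ col H j # drop (Suc j) (cols H))"
    using * by simp
  ultimately show ?thesis unfolding cols_delete_col by auto
qed

text \<open>The dependency among three columns is a codeword of weight 3. Words at distance 1 or 2
  would give a zero column or two proportional ones, impossible for distinct normalized
  columns.\<close>

lemma min_distance_eq_3:
  fixes H :: "'a :: field mat"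
  assumes H: "H \<in> carrier_mat m n" and dist: "distinct (cols H)"
    and norm: "\<And>j. j < n \<Longrightarrow> normalized (col H j)"
    and j: "j0 < n" "j1 < n" "j2 < n" "distinct [j0, j1, j2]"
    and c: "c0 \<noteq> 0" "c1 \<noteq> 0" "c2 \<noteq> 0"
    and dep: "\<And>r. r < m \<Longrightarrow> c0 * H $$ (r, j0) + c1 * H $$ (r, j1) + c2 * H $$ (r, j2) = 0"
  shows "min_distance (mat_kernel H) = 3"
  unfolding min_distance_def
proof (rule cInf_eq_minimum)
  define w where "w = vec n (\<lambda>k. (if k = j0 then c0 else 0) + (if k = j1 then c1 else 0)
      + (if k = j2 then c2 else 0))"
  have "(H *\<^sub>v w) $ r = 0" if "r < m" for r
  proof -
    have "(H *\<^sub>v w) $ r = (\<Sum>k<n. H $$ (r, k) * w $ k)"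
      using H that
      by (auto simp: mult_mat_vec_def scalar_prod_def w_def lessThan_atLeast0 intro!: sum.cong)
    also have "\<dots> = (\<Sum>k<n. (if k = j0 then c0 * H $$ (r, j0) else 0)
        + (if k = j1 then c1 * H $$ (r, j1) else 0) + (if k = j2 then c2 * H $$ (r, j2) else 0))"
      by (rule sum.cong) (auto simp: w_def algebra_simps)
    also have "\<dots> = c0 * H $$ (r, j0) + c1 * H $$ (r, j1) + c2 * H $$ (r, j2)"
      using j by (simp add: sum.distrib)
    finally show ?thesis using dep[OF that] by simp
  qed
  then have "w \<in> mat_kernel H"
    using H by (intro mat_kernelI[OF H]) (auto simp: w_def)
  moreover have "0\<^sub>v n \<in> mat_kernel H" using H by (intro mat_kernelI[OF H]) auto
  moreover have "{i. i < dim_vec w \<and> w $ i \<noteq> 0\<^sub>v n $ i} = {j0, j1, j2}"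
    using j c by (auto simp: w_def split: if_splits)
  then have "hamming_dist w (0\<^sub>v n) = 3" using j by (simp add: hamming_dist_def)
  moreover from this have "w \<noteq> 0\<^sub>v n" by (auto simp: hamming_dist_def)
  ultimately show "3 \<in> {hamming_dist u v |u v. u \<in> mat_kernel H \<and> v \<in> mat_kernel H \<and> u \<noteq> v}"
    by force
next
  fix d assume "d \<in> {hamming_dist u v |u v. u \<in> mat_kernel H \<and> v \<in> mat_kernel H \<and> u \<noteq> v}"
  then obtain u v where uv: "d = hamming_dist u v" "u \<in> mat_kernel H" "v \<in> mat_kernel H" "u \<noteq> v"
    by blast
  \<comment> \<open>The support of \<open>u - v\<close>; its entries are the coefficients of a
    dependency among the columns indexed by \<open>D\<close>.\<close>
  define D where "D = {i. i < n \<and> u $ i \<noteq> v $ i}"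
  have u: "u \<in> carrier_vec n" "H *\<^sub>v u = 0\<^sub>v m" and v: "v \<in> carrier_vec n" "H *\<^sub>v v = 0\<^sub>v m"
    using mat_kernelD[OF H] uv by blast+
  have dD: "d = card D" using uv(1) u by (simp add: hamming_dist_def D_def)
  have sum0: "(\<Sum>k\<in>D. H $$ (r, k) * (u $ k - v $ k)) = 0" if "r < m" for r
  proof -
    have "(\<Sum>k<n. H $$ (r, k) * y $ k) = 0" if y: "y \<in> carrier_vec n" "H *\<^sub>v y = 0\<^sub>v m" for y
    proof -
      have "(H *\<^sub>v y) $ r = (\<Sum>k<n. H $$ (r, k) * y $ k)"
        using H \<open>r < m\<close> y(1)
        by (auto simp: mult_mat_vec_def scalar_prod_def lessThan_atLeast0 intro!: sum.cong)
      then show ?thesis using y \<open>r < m\<close> by simp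
    qed
    then have "(\<Sum>k<n. H $$ (r, k) * (u $ k - v $ k)) = 0"
      using u v by (simp add: right_diff_distrib sum_subtractf)
    moreover have "(\<Sum>k<n. H $$ (r, k) * (u $ k - v $ k)) = (\<Sum>k\<in>D. H $$ (r, k) * (u $ k - v $ k))"
      by (rule sum.mono_neutral_right) (auto simp: D_def)
    ultimately show ?thesis by simp
  qed
  have "D \<noteq> {}" using uv(4) u(1) v(1) by (auto simp: D_def intro: eq_vecI)
  have "finite D" by (simp add: D_def)
  show "3 \<le> d"
  proof (rule ccontr)
    assume "\<not> 3 \<le> d"
    then have "card D = 0 \<or> card D = 1 \<or> card D = 2" using dD by linarith
    then consider i where "D = {i}" | i k where "D = {i, k}" "i \<noteq> k"
      using \<open>D \<noteq> {}\<close> \<open>finite D\<close> by (auto simp: card_1_singleton_iff card_2_iff)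
    then show False
    proof cases
      case 1
      then have i: "i < n" "u $ i - v $ i \<noteq> 0" by (auto simp: D_def)
      then have "col H i $ r = 0" if "r < m" for r
        using sum0[OF that] 1 H that by simp
      then show False using norm[OF i(1)] H by (auto simp: normalized_def)
    next
      case 2
      then have i: "i < n" "u $ i - v $ i \<noteq> 0" and k: "k < n" "u $ k - v $ k \<noteq> 0"
        by (auto simp: D_def)
      let ?l = "- (u $ k - v $ k) / (u $ i - v $ i)"
      have "col H i $ r = ?l * col H k $ r" if "r < m" for r
      proof -
        have "H $$ (r, i) * (u $ i - v $ i) = - (u $ k - v $ k) * H $$ (r, k)"
          using sum0[OF that] 2 by (simp add: eq_neg_iff_add_eq_0 mult.commute del: minus_diff_eq)
        then have "H $$ (r, i) = ?l * H $$ (r, k)" using i(2) by (simp add: nonzero_eq_divide_eq)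
        then show ?thesis using H that i k by simp
      qed
      then have "col H i = col H k"
        using normalized_unique[OF norm[OF i(1)] norm[OF k(1)], of ?l] H by simp
      then show False using dist i k 2(2) H
        by (metis carrier_matD(2) cols_length cols_nth nth_eq_iff_index_eq)
    qed
  qed
qed

section \<open>Parameters and local optimality of the code\<close>

context
  fixes H :: "'a :: {field, finite} mat" and \<rho> :: nat
  assumes q: "CARD('a) \<ge> 4"
    and row: "dim_row H = 2 * \<rho> + 2" and dist: "distinct (cols H)"
    and cols: "set (cols H) = all_cols \<rho>"
begin

lemma covering_radius_eq: "covering_radius H = enat (\<rho> + 1)"
proof (rule antisym)
  have "covered_by H (\<rho> + 1)"
    using reach_all[OF q, of _ \<rho>] unfolding covered_by_def reach_def row cols by blast
  then show "covering_radius H \<le> enat (\<rho> + 1)"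
    unfolding covering_radius_def by (intro Inf_lower) blast
  \<comment> \<open>The conditional with equal branches matches
    \<open>not_covered_without_block_col\<close> at \<open>u = 0\<close> and
    \<open>a = 0\<close>.\<close>
  let ?s = "vec (2 * \<rho> + 2) (\<lambda>i. \<Sum>w\<le>\<rho>. block_col (2 * \<rho> + 2) w (if w = 0 then 0 else (0 :: 'a)) $ i)"
  have "enat (Suc \<rho>) \<le> covering_radius H"
  proof (rule covering_radius_geI)
    show "?s \<in> carrier_vec (dim_row H)" by (simp add: row)
    fix T assume T: "T \<subseteq> set (cols H)" "card T \<le> \<rho>"
    show "?s \<notin> vec_span (dim_row H) T"
      unfolding row using T finite_subset[OF T(1) finite_set] cols
      by (intro not_covered_without_block_col) auto
  qed
  then show "enat (\<rho> + 1) \<le> covering_radius H" by simp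
qed

lemma locally_optimal_all_cols: "locally_optimal H"
  unfolding locally_optimal_def
proof (intro allI impI)
  fix j assume j: "j < dim_col H"
  let ?H = "delete_col H j"
  have row': "dim_row ?H = 2 * \<rho> + 2" by (simp add: delete_col_def row)
  have cols': "set (cols ?H) = all_cols \<rho> - {col H j}"
    using set_cols_delete_col[OF dist j] cols by simp
  have "col H j \<in> all_cols \<rho>" unfolding cols[symmetric] using j by (metis cols_length cols_nth nth_mem)
  then consider u a where "col H j = block_col (2 * \<rho> + 2) u a" "u \<le> \<rho>"
    | "col H j = unit_vec (2 * \<rho> + 2) (2 * \<rho> + 1)"
    by (auto simp: all_cols_def)
  then have "enat (Suc (\<rho> + 1)) \<le> covering_radius ?H"
  proof cases
    case 1
    let ?s = "vec (2 * \<rho> + 2) (\<lambda>i. \<Sum>w\<le>\<rho>. block_col (2 * \<rho> + 2) w (if w = u then a else 0) $ i)"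
    show ?thesis
    proof (rule covering_radius_geI)
      show "?s \<in> carrier_vec (dim_row ?H)" by (simp add: row')
      fix T assume T: "T \<subseteq> set (cols ?H)" "card T \<le> \<rho> + 1"
      show "?s \<notin> vec_span (dim_row ?H) T"
        unfolding row' using T finite_subset[OF T(1) finite_set] 1 cols'
        by (intro not_covered_without_block_col) auto
    qed
  next
    case 2
    let ?s = "vec (2 * \<rho> + 2) (\<lambda>i. if i = 2 * \<rho> \<or> odd i \<and> i < 2 * \<rho> then 0 else (1 :: 'a))"
    show ?thesis
    proof (rule covering_radius_geI)
      show "?s \<in> carrier_vec (dim_row ?H)" by (simp add: row')
      fix T assume T: "T \<subseteq> set (cols ?H)" "card T \<le> \<rho> + 1"
      show "?s \<notin> vec_span (dim_row ?H) T"
        unfolding row' using T finite_subset[OF T(1) finite_set] 2 cols'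
        by (intro not_covered_without_last) auto
    qed
  qed
  moreover have "enat (\<rho> + 1) < enat (Suc (\<rho> + 1))" by simp
  ultimately show "covering_radius H < covering_radius ?H"
    unfolding covering_radius_eq by (rule less_le_trans[rotated])
qed

lemma dim_col_eq: "dim_col H = (\<rho> + 1) * CARD('a) + 1"
  using distinct_card[OF dist] by (simp add: cols card_all_cols)

lemma kernel_dim_eq: "kernel_dim H = dim_col H - (2 * \<rho> + 2)"
proof -
  have "carrier_vec (2 * \<rho> + 2) \<subseteq> vec_span (2 * \<rho> + 2) (set (cols H))"
  proof
    fix x :: "'a vec" assume "x \<in> carrier_vec (2 * \<rho> + 2)"
    then obtain T where T: "T \<subseteq> set (cols H)" "x \<in> vec_span (2 * \<rho> + 2) T"
      using reach_all[OF q, of x \<rho>] unfolding reach_def cols by blast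
    interpret vec_space "TYPE('a)" "2 * \<rho> + 2" .
    show "x \<in> span (set (cols H))" using span_is_monotone[OF T(1)] T(2) by blast
  qed
  moreover have "H \<in> carrier_mat (2 * \<rho> + 2) (dim_col H)" using row by (intro carrier_matI) simp_all
  ultimately have "kernel_dim H + (2 * \<rho> + 2) = dim_col H"
    using kernel_dim_of_spanning_cols dist by blast
  then show ?thesis by linarith
qed

text \<open>Block 0 is part of a line, so three of its columns are dependent:
  \<open>(c - 1)(1, 0) - c(1, 1) + (1, c) = 0\<close>, where \<open>c\<close> differs from
  \<open>0\<close> and \<open>1\<close> to keep all coefficients nonzero.\<close>

lemma min_distance_eq: "min_distance (mat_kernel H) = 3"
proof -
  have "card {0, 1 :: 'a} < CARD('a)" using q by simp
  then have "{0, 1 :: 'a} \<noteq> UNIV" by (metis less_irrefl)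
  then obtain c :: 'a where c: "c \<noteq> 0" "c \<noteq> 1" by blast
  let ?D = "block_col (2 * \<rho> + 2) 0 :: 'a \<Rightarrow> _"
  have "\<exists>j < dim_col H. col H j = ?D a" for a
    using block_col_in[of 0 \<rho> a] unfolding cols[symmetric] in_set_conv_nth by auto
  then obtain f where f: "\<And>a. f a < dim_col H" "\<And>a. col H (f a) = ?D a" by metis
  have inj: "a = b" if "f a = f b" for a b
  proof -
    have "?D a = ?D b" using f(2) that by metis
    then show ?thesis using block_col_inj[of "2 * \<rho> + 2" 0 a 0 b] by simp
  qed
  have "distinct [f 0, f 1, f c]"
    using c inj[of 0 1] inj[of 0 c] inj[of 1 c] by auto
  moreover have "(c - 1) * H $$ (r, f 0) + (- c) * H $$ (r, f 1) + 1 * H $$ (r, f c) = 0"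
    if r: "r < 2 * \<rho> + 2" for r
  proof -
    have "H $$ (r, f a) = ?D a $ r" for a
      using f[of a] r row by (metis index_col)
    then show ?thesis using r by (simp add: block_col_def)
  qed
  moreover have "normalized (col H j)" if "j < dim_col H" for j
    using normalized_all_cols[of "col H j" \<rho>] that unfolding cols[symmetric]
    by (metis cols_length cols_nth nth_mem)
  ultimately show ?thesis
    using c row f by (intro min_distance_eq_3[of H "2 * \<rho> + 2" "dim_col H" "f 0" "f 1" "f c"
          "c - 1" "- c" 1] dist) auto
qed

end

theorem theorem3p2:
  fixes H :: "'a :: {field, finite} mat" and q R \<rho> :: nat
  assumes "CARD('a) = q"
    and "R \<ge> 1" and "\<rho> = R - 1"
    and "has_point_columns H (2 * \<rho> + 2) (S_set \<rho>)"
  shows "(q = 4 \<or> q \<ge> 7 \<longrightarrow>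
            parity_check_of_code H q (R * q + 1) (R * q + 1 - 2 * R) 3 R \<and> locally_optimal H)
       \<and> (q = 5 \<and> R \<le> 5 \<longrightarrow>
            parity_check_of_code H q (5 * R + 1) (5 * R + 1 - 2 * R) 3 R \<and> locally_optimal H)"
proof -
  have R: "R = \<rho> + 1" using assms by simp
  have "parity_check_of_code H q (R * q + 1) (R * q + 1 - 2 * R) 3 R \<and> locally_optimal H"
    if q: "q \<ge> 4"
  proof -
    have row: "dim_row H = 2 * \<rho> + 2" and dist: "distinct (cols H)"
      and cols: "set (cols H) = all_cols \<rho>"
      using assms(4) unfolding has_point_columns_def normalized_points_S_set by blast+
    have q': "CARD('a) \<ge> 4" using q assms(1) by simp
    note facts = q' row dist cols
    have n: "dim_col H = R * q + 1" using dim_col_eq[OF facts] R assms(1) by simp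
    \<comment> \<open>Guards the truncated subtraction in the number of rows.\<close>
    have "2 * R \<le> R * q" using q by simp
    then have "R * q + 1 - (R * q + 1 - 2 * R) = 2 * \<rho> + 2" using R by simp
    then have "H \<in> carrier_mat (R * q + 1 - (R * q + 1 - 2 * R)) (R * q + 1)"
      using row n by auto
    moreover have "kernel_dim H = R * q + 1 - 2 * R" using kernel_dim_eq[OF facts] n R by simp
    ultimately show ?thesis
      unfolding parity_check_of_code_def
      using assms(1) min_distance_eq[OF facts] covering_radius_eq[OF facts]
        locally_optimal_all_cols[OF facts] R by simp
  qed
  then show ?thesis by (auto simp: mult.commute)
qed

end
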